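(* Let $n, r, s$ be integers with $0 \leq s < r \leq n/2$. Let $\mathcal{F}$ be a family of $r$-subsets of $[n]$, let $\mathcal{F}^c = \binom{[n]}{r} \setminus \mathcal{F}$, and let $K$ be any field. If $|\mathcal{F}^c| \leq \frac{n-1}{r}$, then $\operatorname{rank}_K(W_{r,s}^{\mathcal{F}}) = \operatorname{rank}_K(W_{r,s})$.
   Context: Here $[n]=\{1,2,\ldots,n\}$ and $\binom{[n]}{r}$ denotes the set of all $r$-subsets of $[n]$. For a family $\mathcal{F}$ of $r$-subsets of $[n]$ (i.e. $\mathcal{F} \subseteq \binom{[n]}{r}$), the higher inclusion matrix $W_{r,s}^{\mathcal{F}}$ is the $(0,1)$-matrix with rows indexed by the $r$-subsets $R \in \mathcal{F}$, columns indexed by all $s$-subsets $S$ of $[n]$, and $(R,S)$-entry equal to $1$ if and only if $S \subseteq R$. When $\mathcal{F} = \binom{[n]}{r}$, one writes $W_{r,s}$ for $W_{r,s}^{\mathcal{F}}$. The notation $\operatorname{rank}_K$ means the rank of the matrix with its entries $0,1$ regarded as elements of $K$. *)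

theory Defs
  imports
    Jordan_Normal_Form.DL_Rank
    "HOL-Library.Nat_Bijection"
    "HOL-Library.Ramsey"
begin

text \<open>
  Library matrices are indexed by initial segments of the naturals, so the rows and columns, which
  are indexed by finite sets of naturals, have to be listed in some order. We use the
  colexicographic order, i.e. the order of the binary codes \<open>\<Sum>i\<in>A. 2 ^ i\<close>. A different order would
  only permute rows and columns and hence not change the rank.
\<close>

definition colex_list :: "nat set set \<Rightarrow> nat set list" where
  "colex_list \<F> = map set_decode (sorted_list_of_set (set_encode ` \<F>))"

lemma
  assumes "finite \<F>" and "\<And>A. A \<in> \<F> \<Longrightarrow> finite A"
  shows set_colex_list: "set (colex_list \<F>) = \<F>"
    and distinct_colex_list: "distinct (colex_list \<F>)"
    and length_colex_list: "length (colex_list \<F>) = card \<F>"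
proof -
  have inj: "inj_on set_encode \<F>"
    using assms(2) by (auto intro!: inj_on_subset[OF inj_on_set_encode])
  show "set (colex_list \<F>) = \<F>"
    using assms by (auto simp: colex_list_def image_image)
  show "distinct (colex_list \<F>)"
    using assms by (auto simp: colex_list_def distinct_map inj_on_def)
  show "length (colex_list \<F>) = card \<F>"
    using inj by (simp add: colex_list_def card_image)
qed

text \<open>
  The higher inclusion matrix \<open>W\<^bsub>r,s\<^esub>\<^sup>\<F>\<close> of a family \<open>\<F>\<close> of \<open>r\<close>-subsets of \<open>{1..n}\<close>, with entries
  in \<open>'k\<close>. The parameter \<open>r\<close> is determined by \<open>\<F>\<close> and therefore omitted; \<open>W\<^bsub>r,s\<^esub>\<close> is the instance
  \<open>\<F> = nsets {1..n} r\<close>.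
\<close>

definition higher_inclusion_mat :: "nat \<Rightarrow> nat \<Rightarrow> nat set set \<Rightarrow> 'k :: zero_neq_one mat" where
  "higher_inclusion_mat n s \<F> =
    (let Rs = colex_list \<F>; Ss = colex_list (nsets {1..n} s)
     in mat (length Rs) (length Ss) (\<lambda>(i, j). if Ss ! j \<subseteq> Rs ! i then 1 else 0))"

text \<open>The first argument of \<^const>\<open>vec_space.rank\<close> is the length of the columns.\<close>

abbreviation mat_rank :: "'k :: field mat \<Rightarrow> nat" where
  "mat_rank A \<equiv> vec_space.rank (dim_row A) A"

end

theory Submission
  imports Defs
begin

text \<open>
  Two matrices over a field have the same rank if each row of either one is a linear combination of
  the rows of the other. The rows of \<open>W\<^bsub>r,s\<^esub>\<^sup>\<F>\<close> are rows of \<open>W\<^bsub>r,s\<^esub>\<close>, so it suffices to write each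
  missing row, of index \<open>R \<in> \<F>\<^sup>c\<close>, as a combination of rows with index in \<open>\<F>\<close>.

  Such a combination comes from a cross-polytope. Let \<open>b\<close> map \<open>R\<close> injectively to its complement, and
  consider the \<open>2\<^sup>r\<close> transversals of the pairs \<open>{x, b x}\<close>, where \<open>x \<in> R\<close>. A set \<open>S\<close> with \<open>s < r\<close>
  elements misses some pair completely, and exchanging the two elements of that pair matches the
  transversals containing \<open>S\<close> in twos of opposite sign. Hence the signed sum of the rows of all
  transversals vanishes, over any field (lemma \<open>transversal_alternating_sum_eq_0\<close>). One of them is
  \<open>R\<close> itself, with coefficient \<open>1\<close>.

  The other transversals have to lie in \<open>\<F>\<close>. They are subsets of \<open>R \<union> B\<close>, where \<open>B = b ` R\<close>, so it is
  enough that \<open>R \<union> B\<close> contains no member of \<open>\<F>\<^sup>c\<close> other than \<open>R\<close>. Every such member, having as many points as \<open>R\<close>, has one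
  outside \<open>R\<close>; if \<open>B\<close> avoids one such point for each of them, then it has this property
  (lemma \<open>ex_extension_containing_no_member\<close>). There is room for \<open>B\<close> if
  \<open>r \<le> (n - r) - (\<bar>\<F>\<^sup>c\<bar> - 1)\<close>, and this follows from \<open>\<bar>\<F>\<^sup>c\<bar> \<le> (n - 1) / r\<close> and \<open>2 r \<le> n\<close>.
\<close>

section \<open>Comparing ranks by row combinations\<close>

lemma (in vec_space) lin_indpt_iff_sum:
  assumes "finite U" and "U \<subseteq> carrier_vec n"
  shows "lin_indpt U \<longleftrightarrow>
    (\<forall>a. (\<forall>i<n. (\<Sum>u\<in>U. a u * u $ i) = 0) \<longrightarrow> (\<forall>u\<in>U. a u = 0))"
proof -
  have zero_iff: "lincomb a U = 0\<^sub>v n \<longleftrightarrow> (\<forall>i<n. (\<Sum>u\<in>U. a u * u $ i) = 0)" for a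
  proof
    assume "lincomb a U = 0\<^sub>v n"
    then show "\<forall>i<n. (\<Sum>u\<in>U. a u * u $ i) = 0"
      using lincomb_index[OF _ assms(2), of _ a] by (metis index_zero_vec(1))
  next
    assume "\<forall>i<n. (\<Sum>u\<in>U. a u * u $ i) = 0"
    then show "lincomb a U = 0\<^sub>v n"
      using lincomb_index[OF _ assms(2), of _ a] lincomb_dim[OF assms, of a]
      by (intro eq_vecI) auto
  qed
  show ?thesis
  proof
    assume "lin_indpt U"
    then show "\<forall>a. (\<forall>i<n. (\<Sum>u\<in>U. a u * u $ i) = 0) \<longrightarrow> (\<forall>u\<in>U. a u = 0)"
      using lin_dep_crit[OF assms(1) subset_refl] zero_iff by metis
  next
    assume "\<forall>a. (\<forall>i<n. (\<Sum>u\<in>U. a u * u $ i) = 0) \<longrightarrow> (\<forall>u\<in>U. a u = 0)"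
    then show "lin_indpt U"
      using finite_lin_dep[OF assms(1)] assms(2) zero_iff by metis
  qed
qed

text \<open>
  If the rows of \<open>A\<close> are combinations of rows of \<open>B\<close>, then every linear relation between columns of
  \<open>B\<close> holds between the corresponding columns of \<open>A\<close>. Independent columns of \<open>A\<close> therefore sit at
  positions where the columns of \<open>B\<close> are independent.
\<close>

lemma mat_rank_le_if_rows_combinations:
  fixes A B :: "'k :: field mat"
  assumes cols: "dim_col A = dim_col B"
    and rows: "\<And>i. i < dim_row A \<Longrightarrow>
      \<exists>c. \<forall>j<dim_col A. A $$ (i, j) = (\<Sum>k<dim_row B. c k * B $$ (k, j))"
  shows "mat_rank A \<le> mat_rank B"
proof -
  interpret VA: vec_space "TYPE('k)" "dim_row A" .
  interpret VB: vec_space "TYPE('k)" "dim_row B" .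
  have "\<forall>i\<in>{..<dim_row A}. \<exists>c. \<forall>j<dim_col A. A $$ (i, j) = (\<Sum>k<dim_row B. c k * B $$ (k, j))"
    using rows by simp
  from bchoice[OF this] obtain c where c: "\<And>i j. i < dim_row A \<Longrightarrow> j < dim_col A \<Longrightarrow>
      A $$ (i, j) = (\<Sum>k<dim_row B. c i k * B $$ (k, j))"
    by auto
  have "VA.lin_indpt {}"
    by (simp add: VA.lin_indpt_iff_sum)
  then obtain U where U: "maximal U (\<lambda>T. T \<subseteq> set (Matrix.cols A) \<and> VA.lin_indpt T)"
    using maximal_exists_superset[of "set (Matrix.cols A)"
        "\<lambda>T. T \<subseteq> set (Matrix.cols A) \<and> VA.lin_indpt T" "{}"] by auto
  then have U_cols: "U \<subseteq> set (Matrix.cols A)" and U_indpt: "VA.lin_indpt U"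
    by (auto simp: maximal_def)
  have U_fin: "finite U"
    using U_cols finite_subset by blast
  have U_carrier: "U \<subseteq> carrier_vec (dim_row A)"
    using U_cols cols_dim by blast
  have rank_A: "VA.rank A = card U"
    by (rule VA.rank_card_indpt[OF carrier_matI[OF refl refl] U])
  have "\<forall>u\<in>U. \<exists>j<dim_col A. u = col A j"
    using U_cols by (fastforce simp: Matrix.cols_def)
  then obtain p where p: "\<And>u. u \<in> U \<Longrightarrow> p u < dim_col A \<and> u = col A (p u)"
    by metis
  define g where "g u = col B (p u)" for u
  have rel: "u $ i = (\<Sum>k<dim_row B. c i k * g u $ k)" if "u \<in> U" "i < dim_row A" for u i
  proof -
    have "u $ i = A $$ (i, p u)"
      using p[OF that(1)] that(2) by (metis index_col)
    then show ?thesis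
      using c that p[OF that(1)] cols by (simp add: g_def)
  qed
  have g_inj: "inj_on g U"
  proof (rule inj_onI)
    fix u v assume uv: "u \<in> U" "v \<in> U" "g u = g v"
    then have "u $ i = v $ i" if "i < dim_row A" for i
      using rel that by simp
    moreover have "u \<in> carrier_vec (dim_row A)" "v \<in> carrier_vec (dim_row A)"
      using uv U_carrier by auto
    ultimately show "u = v"
      by (intro eq_vecI) auto
  qed
  have g_carrier: "g ` U \<subseteq> carrier_vec (dim_row B)"
    by (auto simp: g_def)
  have "a w = 0"
    if a: "\<forall>k<dim_row B. (\<Sum>w\<in>g ` U. a w * w $ k) = 0" and w: "w \<in> g ` U" for a w
  proof -
    have "(\<Sum>u\<in>U. a (g u) * u $ i) = 0" if i: "i < dim_row A" for i
    proof -
      have "(\<Sum>u\<in>U. a (g u) * u $ i) =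
          (\<Sum>u\<in>U. \<Sum>k<dim_row B. c i k * (a (g u) * g u $ k))"
        using rel i by (intro sum.cong) (auto simp: sum_distrib_left mult.left_commute)
      also have "\<dots> = (\<Sum>k<dim_row B. c i k * (\<Sum>u\<in>U. a (g u) * g u $ k))"
        by (subst sum.swap) (simp add: sum_distrib_left)
      also have "\<dots> = 0"
        using a by (simp add: sum.reindex[OF g_inj])
      finally show ?thesis .
    qed
    then have "\<forall>u\<in>U. a (g u) = 0"
      using U_indpt VA.lin_indpt_iff_sum[OF U_fin U_carrier] by (auto dest: spec[of _ "\<lambda>u. a (g u)"])
    then show ?thesis
      using w by auto
  qed
  then have "VB.lin_indpt (g ` U)"
    using VB.lin_indpt_iff_sum[OF finite_imageI[OF U_fin] g_carrier] by blast
  moreover have "g ` U \<subseteq> set (Matrix.cols B)"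
    using p cols by (auto simp: g_def Matrix.cols_def)
  ultimately have "card (g ` U) \<le> VB.rank B"
    by (intro VB.rank_ge_card_indpt[OF carrier_matI[OF refl refl]])
  then show ?thesis
    using rank_A card_image[OF g_inj] by simp
qed

lemma mat_rank_higher_inclusion_mat_le:
  fixes \<F> \<G> :: "nat set set"
  assumes fin: "finite \<F>" "\<And>R. R \<in> \<F> \<Longrightarrow> finite R" "finite \<G>" "\<And>Q. Q \<in> \<G> \<Longrightarrow> finite Q"
    and comb: "\<And>R. R \<in> \<F> \<Longrightarrow> \<exists>c. \<forall>S\<in>nsets {1..n} s.
      (of_bool (S \<subseteq> R) :: 'k :: field) = (\<Sum>Q\<in>\<G>. c Q * of_bool (S \<subseteq> Q))"
  shows "mat_rank (higher_inclusion_mat n s \<F> :: 'k mat) \<le> mat_rank (higher_inclusion_mat n s \<G> :: 'k mat)"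
proof (rule mat_rank_le_if_rows_combinations)
  define Ss where "Ss = colex_list (nsets {1..n} s)"
  have W_def: "higher_inclusion_mat n s \<H> =
      mat (length (colex_list \<H>)) (length Ss) (\<lambda>(i, j). of_bool (Ss ! j \<subseteq> colex_list \<H> ! i))"
    for \<H>
    by (auto simp: higher_inclusion_mat_def Ss_def Let_def)
  have "finite (nsets {1..n} s)" "\<And>S. S \<in> nsets {1..n} s \<Longrightarrow> finite S"
    by (auto simp: nsets_def finite_imp_finite_nsets)
  then have Ss: "set Ss = nsets {1..n} s"
    unfolding Ss_def by (rule set_colex_list)
  show "dim_col (higher_inclusion_mat n s \<F> :: 'k mat) = dim_col (higher_inclusion_mat n s \<G> :: 'k mat)"
    by (simp add: W_def)
  fix i assume i: "i < dim_row (higher_inclusion_mat n s \<F> :: 'k mat)"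
  then have "colex_list \<F> ! i \<in> \<F>"
    using set_colex_list[OF fin(1,2)] nth_mem by (fastforce simp: W_def)
  from comb[OF this] obtain c where c: "\<forall>S\<in>nsets {1..n} s.
      (of_bool (S \<subseteq> colex_list \<F> ! i) :: 'k) = (\<Sum>Q\<in>\<G>. c Q * of_bool (S \<subseteq> Q))"
    by blast
  have bij: "bij_betw (nth (colex_list \<G>)) {..<length (colex_list \<G>)} \<G>"
    using bij_betw_nth[OF distinct_colex_list refl set_colex_list[symmetric]] fin(3,4) by blast
  show "\<exists>c. \<forall>j<dim_col (higher_inclusion_mat n s \<F> :: 'k mat).
      (higher_inclusion_mat n s \<F> :: 'k mat) $$ (i, j) =
      (\<Sum>k<dim_row (higher_inclusion_mat n s \<G> :: 'k mat).
        c k * (higher_inclusion_mat n s \<G> :: 'k mat) $$ (k, j))"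
  proof (intro exI allI impI)
    fix j assume j: "j < dim_col (higher_inclusion_mat n s \<F> :: 'k mat)"
    then have "Ss ! j \<in> nsets {1..n} s"
      using Ss nth_mem by (fastforce simp: W_def)
    then have "(higher_inclusion_mat n s \<F> :: 'k mat) $$ (i, j) =
        (\<Sum>Q\<in>\<G>. c Q * of_bool (Ss ! j \<subseteq> Q))"
      using c i j by (simp add: W_def)
    also have "\<dots> = (\<Sum>k<length (colex_list \<G>).
        c (colex_list \<G> ! k) * of_bool (Ss ! j \<subseteq> colex_list \<G> ! k))"
      by (rule sum.reindex_bij_betw[OF bij, symmetric])
    also have "\<dots> = (\<Sum>k<dim_row (higher_inclusion_mat n s \<G> :: 'k mat).
        c (colex_list \<G> ! k) * (higher_inclusion_mat n s \<G> :: 'k mat) $$ (k, j))"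
      using j by (intro sum.cong) (auto simp: W_def)
    finally show "(higher_inclusion_mat n s \<F> :: 'k mat) $$ (i, j) =
        (\<Sum>k<dim_row (higher_inclusion_mat n s \<G> :: 'k mat).
          c (colex_list \<G> ! k) * (higher_inclusion_mat n s \<G> :: 'k mat) $$ (k, j))" .
  qed
qed

section \<open>The cross-polytope relation\<close>

text \<open>The transversal of the pairs \<open>{x, b x}\<close>, \<open>x \<in> R\<close>, that keeps exactly the points of \<open>T \<subseteq> R\<close>.\<close>

definition transversal :: "'a set \<Rightarrow> ('a \<Rightarrow> 'a) \<Rightarrow> 'a set \<Rightarrow> 'a set" where
  "transversal R b T = T \<union> b ` (R - T)"

lemma transversal_self [simp]: "transversal R b R = R"
  by (simp add: transversal_def)

lemma transversal_Int:
  assumes "T \<subseteq> R" and "b ` R \<inter> R = {}"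
  shows "transversal R b T \<inter> R = T"
  using assms by (auto simp: transversal_def)

lemma card_transversal:
  assumes "finite R" and "inj_on b R" and "b ` R \<inter> R = {}" and "T \<subseteq> R"
  shows "card (transversal R b T) = card R"
proof -
  have "card (transversal R b T) = card T + card (b ` (R - T))"
    unfolding transversal_def using assms by (intro card_Un_disjoint) (auto intro: finite_subset)
  also have "card (b ` (R - T)) = card R - card T"
    using assms by (simp add: card_image inj_on_diff card_Diff_subset finite_subset)
  also have "card T + (card R - card T) = card R"
    using assms card_mono by force
  finally show ?thesis .
qed

lemma ex_pair_disjoint_from_small_set:
  assumes "finite S" and "card S < card R" and "inj_on b R" and "b ` R \<inter> R = {}"
  obtains x where "x \<in> R" and "x \<notin> S" and "b x \<notin> S"
proof -
  have "\<exists>x\<in>R. x \<notin> S \<and> b x \<notin> S"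
  proof (rule ccontr)
    assume meets: "\<not> (\<exists>x\<in>R. x \<notin> S \<and> b x \<notin> S)"
    define f where "f x = (if x \<in> S then x else b x)" for x
    have "f ` R \<subseteq> S"
      using meets by (auto simp: f_def)
    moreover have "inj_on f R"
      using assms(3,4) unfolding f_def inj_on_def by (auto split: if_splits)
    ultimately have "card R \<le> card S"
      using assms(1) card_inj_on_le by blast
    then show False
      using assms(2) by simp
  qed
  then show ?thesis
    using that by blast
qed

lemma transversal_alternating_sum_eq_0:
  assumes "finite R" and "finite S" and "card S < card R"
    and "inj_on b R" and "b ` R \<inter> R = {}"
  shows "(\<Sum>T\<in>Pow R. (- 1) ^ card (R - T) * of_bool (S \<subseteq> transversal R b T)) = (0 :: 'k :: comm_ring_1)"
proof -
  obtain x where x: "x \<in> R" "x \<notin> S" "b x \<notin> S"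
    using ex_pair_disjoint_from_small_set[OF assms(2-5)] .
  define P where "P = Pow (R - {x})"
  define f where "f T = ((- 1) ^ card (R - T) * of_bool (S \<subseteq> transversal R b T) :: 'k)" for T
  have Pow_R: "Pow R = P \<union> insert x ` P"
    using x(1) Pow_insert[of x "R - {x}"] by (simp add: P_def insert_absorb)
  have inj: "inj_on (insert x) P"
    by (auto simp: P_def inj_on_def)
  have cancel: "f T + f (insert x T) = 0" if "T \<in> P" for T
  proof -
    have T: "T \<subseteq> R" "x \<notin> T"
      using that by (auto simp: P_def)
    have "R - T = insert x (R - insert x T)"
      using x(1) T by auto
    then have "b ` (R - T) = insert (b x) (b ` (R - insert x T))"
      and card: "card (R - T) = Suc (card (R - insert x T))"
      using assms(1) by (metis image_insert, metis card_insert_disjoint finite_Diff Diff_iff insertI1)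
    then have "S \<subseteq> transversal R b T \<longleftrightarrow> S \<subseteq> transversal R b (insert x T)"
      using x(2,3) by (auto simp: transversal_def)
    then show ?thesis
      by (simp add: f_def card)
  qed
  have "(\<Sum>T\<in>Pow R. f T) = (\<Sum>T\<in>P. f T) + (\<Sum>T\<in>insert x ` P. f T)"
    unfolding Pow_R by (rule sum.union_disjoint) (use assms(1) in \<open>auto simp: P_def\<close>)
  also have "\<dots> = (\<Sum>T\<in>P. f T + f (insert x T))"
    by (simp add: sum.reindex[OF inj] sum.distrib)
  also have "\<dots> = 0"
    using cancel by simp
  finally show ?thesis
    by (simp add: f_def)
qed

text \<open>
  Solving the cross-polytope relation for the row of \<open>R\<close>. As \<open>T\<close> is recovered from its transversal
  by intersecting with \<open>R\<close>, distinct \<open>T\<close> give distinct rows and the coefficient of a row is a sign.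
\<close>

lemma row_combination_of_transversals:
  assumes "finite R" and "inj_on b R" and "b ` R \<inter> R = {}"
    and "finite \<G>" and trans: "\<And>T. T \<subset> R \<Longrightarrow> transversal R b T \<in> \<G>"
  shows "\<exists>c. \<forall>S. finite S \<and> card S < card R \<longrightarrow>
    (of_bool (S \<subseteq> R) :: 'k :: comm_ring_1) = (\<Sum>Q\<in>\<G>. c Q * of_bool (S \<subseteq> Q))"
proof -
  define P where "P = Pow R - {R}"
  define \<Q> where "\<Q> = transversal R b ` P"
  define c where "c Q = (if Q \<in> \<Q> then - ((- 1) ^ card (R - Q)) else 0 :: 'k)" for Q
  have "inj_on (transversal R b) (Pow R)"
    using transversal_Int[OF _ assms(3)] by (intro inj_on_inverseI[of _ "\<lambda>Q. Q \<inter> R"]) auto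
  then have inj: "inj_on (transversal R b) P"
    by (rule inj_on_subset) (auto simp: P_def)
  have \<Q>: "\<Q> \<subseteq> \<G>"
    using trans by (auto simp: \<Q>_def P_def)
  have "of_bool (S \<subseteq> R) = (\<Sum>Q\<in>\<G>. c Q * of_bool (S \<subseteq> Q))" if "finite S" "card S < card R" for S
  proof -
    define f where "f T = ((- 1) ^ card (R - T) * of_bool (S \<subseteq> transversal R b T) :: 'k)" for T
    have "(\<Sum>Q\<in>\<G>. c Q * of_bool (S \<subseteq> Q)) = (\<Sum>Q\<in>\<Q>. c Q * of_bool (S \<subseteq> Q))"
      using \<open>finite \<G>\<close> \<Q> by (intro sum.mono_neutral_right) (auto simp: c_def)
    also have "\<dots> = (\<Sum>T\<in>P. c (transversal R b T) * of_bool (S \<subseteq> transversal R b T))"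
      by (simp add: \<Q>_def sum.reindex[OF inj])
    also have "\<dots> = (\<Sum>T\<in>P. - f T)"
    proof (rule sum.cong[OF refl])
      fix T assume T: "T \<in> P"
      have "R - transversal R b T = R - T"
        using transversal_Int[OF _ assms(3), of T] T by (auto simp: P_def)
      then show "c (transversal R b T) * of_bool (S \<subseteq> transversal R b T) = - f T"
        using T by (simp add: c_def \<Q>_def f_def)
    qed
    also have "\<dots> = f R - (\<Sum>T\<in>Pow R. f T)"
      using assms(1) by (simp add: P_def sum_negf sum.remove[of "Pow R" R])
    also have "\<dots> = of_bool (S \<subseteq> R)"
      using transversal_alternating_sum_eq_0[OF assms(1) that assms(2,3), where 'k = 'k]
      by (simp add: f_def del: sum_mult_of_bool_eq)
    finally show ?thesis ..
  qed
  then show ?thesis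
    by blast
qed

section \<open>Avoiding the removed sets\<close>

lemma ex_extension_containing_no_member:
  assumes "finite V" and "finite \<N>" and "R \<subseteq> V" and "\<And>Q. Q \<in> \<N> \<Longrightarrow> \<not> Q \<subseteq> R"
    and "card R + card \<N> + k \<le> card V"
  obtains B where "B \<subseteq> V - R" and "card B = k" and "\<And>Q. Q \<in> \<N> \<Longrightarrow> \<not> Q \<subseteq> R \<union> B"
proof -
  have "\<forall>Q\<in>\<N>. \<exists>x. x \<in> Q - R"
    using assms(4) by blast
  from bchoice[OF this] obtain p where p: "\<forall>Q\<in>\<N>. p Q \<in> Q - R" ..
  have "card (V - R) = card V - card R"
    using assms(1,3) finite_subset by (intro card_Diff_subset) auto
  moreover have "card (p ` \<N>) \<le> card \<N>"
    using assms(2) by (rule card_image_le)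
  moreover have "card (V - R) - card (p ` \<N>) \<le> card (V - R - p ` \<N>)"
    using assms(2) by (intro diff_card_le_card_Diff) simp
  ultimately have "k \<le> card (V - R - p ` \<N>)"
    using assms(5) by linarith
  then obtain B where "B \<subseteq> V - R - p ` \<N>" "card B = k"
    by (meson obtain_subset_with_card_n)
  then show ?thesis
    using p by (intro that[of B]) blast+
qed

text \<open>
  Write \<open>n = 2 * r + d\<close>. If \<open>m > d + 1\<close>, then \<open>m * r \<ge> 2 * r + d * r\<close>, which exceeds \<open>n - 1\<close>.
\<close>

lemma card_bound_leaves_room:
  fixes m n r :: nat
  assumes "0 < r" and "2 * r \<le> n" and "m * r < n"
  shows "m + 2 * r \<le> n + 1"
proof (rule ccontr)
  assume "\<not> m + 2 * r \<le> n + 1"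
  moreover obtain d where d: "n = 2 * r + d"
    using assms(2) le_Suc_ex by blast
  ultimately have "d + 2 \<le> m"
    by simp
  then have "(d + 2) * r \<le> m * r"
    by (rule mult_le_mono1)
  moreover have "d \<le> d * r"
    using assms(1) by simp
  ultimately show False
    using assms(3) d by (simp add: algebra_simps)
qed

theorem theorem4:
  fixes n r s :: nat and \<F> :: "nat set set"
  assumes "s < r" and "real r \<le> real n / 2"
    and "\<F> \<subseteq> nsets {1..n} r"
    and "real (card (nsets {1..n} r - \<F>)) \<le> (real n - 1) / real r"
  shows "mat_rank (higher_inclusion_mat n s \<F> :: 'k :: field mat)
       = mat_rank (higher_inclusion_mat n s (nsets {1..n} r) :: 'k mat)"
proof (rule antisym)
  define \<G> where "\<G> = nsets {1..n} r"
  have mem: "R \<subseteq> {1..n} \<and> finite R \<and> card R = r" if "R \<in> \<G>" for R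
    using that by (auto simp: \<G>_def nsets_def)
  have \<F>_sub: "\<F> \<subseteq> \<G>"
    using assms(3) by (simp add: \<G>_def)
  have \<G>_fin: "finite \<G>"
    by (simp add: \<G>_def finite_imp_finite_nsets)
  with \<F>_sub have \<F>_fin: "finite \<F>"
    by (rule finite_subset)
  have own_row: "\<exists>c. \<forall>S\<in>nsets {1..n} s.
      (of_bool (S \<subseteq> R) :: 'k) = (\<Sum>Q\<in>\<H>. c Q * of_bool (S \<subseteq> Q))"
    if "R \<in> \<H>" "finite \<H>" for R and \<H> :: "nat set set"
  proof (intro exI ballI)
    fix S
    have "(of_bool (S \<subseteq> R) :: 'k) = (\<Sum>Q\<in>\<H>. if Q = R then of_bool (S \<subseteq> Q) else 0)"
      using that by (simp add: sum.delta)
    also have "\<dots> = (\<Sum>Q\<in>\<H>. of_bool (Q = R) * of_bool (S \<subseteq> Q))"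
      by (intro sum.cong) auto
    finally show "(of_bool (S \<subseteq> R) :: 'k) = (\<Sum>Q\<in>\<H>. of_bool (Q = R) * of_bool (S \<subseteq> Q))" .
  qed
  have \<G>_members_fin: "\<And>R. R \<in> \<G> \<Longrightarrow> finite R" and \<F>_members_fin: "\<And>R. R \<in> \<F> \<Longrightarrow> finite R"
    using mem \<F>_sub by auto
  show "mat_rank (higher_inclusion_mat n s \<F> :: 'k mat) \<le>
      mat_rank (higher_inclusion_mat n s (nsets {1..n} r) :: 'k mat)"
    unfolding \<G>_def[symmetric]
    using \<F>_fin \<F>_members_fin \<G>_fin \<G>_members_fin own_row[OF subsetD[OF \<F>_sub] \<G>_fin]
    by (rule mat_rank_higher_inclusion_mat_le)
  have r: "0 < r" "2 * r \<le> n"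
    using assms(1,2) by auto
  have "real (card (\<G> - \<F>)) * real r \<le> real n - 1"
    using assms(4) r(1) by (simp add: \<G>_def pos_le_divide_eq)
  then have "card (\<G> - \<F>) * r < n"
    by (metis (mono_tags) of_nat_mult of_nat_less_iff le_less_trans diff_less_eq less_add_one)
  then have room: "card (\<G> - \<F>) + 2 * r \<le> n + 1"
    using r by (intro card_bound_leaves_room)
  have "\<exists>c. \<forall>S\<in>nsets {1..n} s.
      (of_bool (S \<subseteq> R) :: 'k) = (\<Sum>Q\<in>\<F>. c Q * of_bool (S \<subseteq> Q))" if R: "R \<in> \<G>" for R
  proof (cases "R \<in> \<F>")
    case True
    then show ?thesis
      using own_row \<F>_fin by blast
  next
    case False
    define \<N> where "\<N> = \<G> - \<F> - {R}"
    have "card (\<G> - \<F>) = Suc (card \<N>)"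
      using R False \<G>_fin unfolding \<N>_def by (intro card.remove) auto
    then have "card R + card \<N> + r \<le> card {1..n}"
      using room mem[OF R] by simp
    moreover have "\<not> Q \<subseteq> R" if "Q \<in> \<N>" for Q
      using that mem[OF R] mem[of Q] card_subset_eq[of R Q] by (auto simp: \<N>_def)
    moreover have "finite \<N>"
      using \<G>_fin by (simp add: \<N>_def)
    ultimately obtain B where B: "B \<subseteq> {1..n} - R" "card B = r" "\<And>Q. Q \<in> \<N> \<Longrightarrow> \<not> Q \<subseteq> R \<union> B"
      using ex_extension_containing_no_member[of "{1..n}" \<N> R r] mem[OF R] by blast
    have "finite B"
      using B(1) finite_subset by blast
    then obtain b where b: "bij_betw b R B"
      using finite_same_card_bij mem[OF R] B(2) by metis
    then have b_inj: "inj_on b R" and b_disj: "b ` R \<inter> R = {}"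
      using B(1) by (auto simp: bij_betw_def)
    have "transversal R b T \<in> \<F>" if "T \<subset> R" for T
    proof -
      have sub: "transversal R b T \<subseteq> R \<union> B"
        using that b by (auto simp: transversal_def bij_betw_def)
      have "finite (transversal R b T)" "transversal R b T \<subseteq> {1..n}"
        using sub B(1) mem[OF R] \<open>finite B\<close> by (auto intro: finite_subset)
      moreover have "card (transversal R b T) = r"
        using card_transversal[OF _ b_inj b_disj, of T] mem[OF R] that by auto
      ultimately have "transversal R b T \<in> \<G>"
        by (simp add: \<G>_def nsets_def)
      moreover have "transversal R b T \<noteq> R"
        using transversal_Int[OF _ b_disj, of T] that by auto
      ultimately show ?thesis
        using B(3)[of "transversal R b T"] sub by (auto simp: \<N>_def)
    qed
    then obtain c where "\<forall>S. finite S \<and> card S < card R \<longrightarrow>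
        (of_bool (S \<subseteq> R) :: 'k) = (\<Sum>Q\<in>\<F>. c Q * of_bool (S \<subseteq> Q))"
      using row_combination_of_transversals[OF _ b_inj b_disj \<F>_fin] mem[OF R] by blast
    then show ?thesis
      using assms(1) mem[OF R] by (intro exI[of _ c]) (auto simp: nsets_def)
  qed
  then show "mat_rank (higher_inclusion_mat n s (nsets {1..n} r) :: 'k mat) \<le>
      mat_rank (higher_inclusion_mat n s \<F> :: 'k mat)"
    unfolding \<G>_def[symmetric]
    by (intro mat_rank_higher_inclusion_mat_le \<F>_fin \<F>_members_fin \<G>_fin \<G>_members_fin)
qed

end
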